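(* Let $n\ge1$, let $\mathcal{E}$ be a Hilbert space, and let $W_L\in\mathcal{B}(\mathcal{F}_n^2\otimes\mathcal{E})$ be an odometer map with symbol $L\in\mathcal{B}(\mathcal{E},\mathcal{F}_n^2\otimes\mathcal{E})$. Let $W_{22}:=P_{\mathcal{M}^\perp}W_L|_{\mathcal{N}^\perp}:\mathcal{N}^\perp\to\mathcal{M}^\perp$. Then the kernel of the adjoint of $W_L$ is given by $$\ker W_L^*=\ker W_{22}^*=\{f\in\mathcal{M}^\perp:L^*(S_1^{*p}\otimes I_{\mathcal{E}})f=0\text{ for all }p\ge0\}=\mathcal{E}_L\cap(L\mathcal{E})^\perp.$$ Moreover, if $(W_L,S^{\mathcal{E}})$ is an isometric representation (that is, $W_L$ is an isometry), then $$\ker W_L^*=\mathcal{E}_L\ominus L\mathcal{E}.$$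
   Context: Hilbert spaces are separable and complex; $\mathcal{B}(\mathcal{H},\mathcal{K})$ denotes bounded linear operators; $P_{\mathcal{S}}$ is the orthogonal projection onto a closed subspace $\mathcal{S}$. $F_n^+$ is the free monoid of words $\mu=\mu_1\cdots\mu_m$ in the letters $1,\dots,n$, with empty word $\emptyset$. The full Fock space $\mathcal{F}_n^2=\mathbb{C}\Omega\oplus\bigoplus_{k\ge1}(\mathbb{C}^n)^{\otimes k}$ has orthonormal basis $e_\mu=e_{\mu_1}\otimes\cdots\otimes e_{\mu_m}$, $\mu\in F_n^+$, with $e_\emptyset=\Omega$; $e_k^m:=e_k^{\otimes m}$, $e_k^0=\Omega$, and $\Omega$ acts as a unit for left tensoring. $S_i f=e_i\otimes f$ is the $i$-th left creation operator on $\mathcal{F}_n^2$, $S^{\mathcal{E}}=(S_1\otimes I_{\mathcal{E}},\dots,S_n\otimes I_{\mathcal{E}})$, and $e_1^p\otimes f$ means $(S_1^p\otimes I_{\mathcal{E}})f$ for $f\in\mathcal{F}_n^2\otimes\mathcal{E}$. Odometer map: for $L\in\mathcal{B}(\mathcal{E},\mathcal{F}_n^2\otimes\mathcal{E})$, $W_L$ is the operator on $\mathcal{F}_n^2\otimes\mathcal{E}$ given by $W_L(\Omega\otimes\eta)=L\eta$; $W_L(e_n^m\otimes\eta)=e_1^m\otimes L\eta$ for $m\ge1$; and, for a nonempty word $\mu=\mu_1\cdots\mu_m$ having some letter $\ne n$, with $k$ the smallest index such that $\mu_k\neq n$, $W_L(e_\mu\otimes\eta)=e_1^{k-1}\otimes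 e_{\mu_k+1}\otimes e_{\mu_{k+1}}\otimes\cdots\otimes e_{\mu_m}\otimes\eta$. It is a standing assumption that $W_L$ is a bounded operator on $\mathcal{F}_n^2\otimes\mathcal{E}$. The pair $(W_L,S^{\mathcal{E}})$ is a (Fock) representation of the odometer semigroup; it is called isometric when $W_L$ is an isometry. $\mathcal{M}^\perp=\overline{\mathrm{span}}\{e_1^m\otimes\xi:m\ge0,\xi\in\mathcal{E}\}$ and $\mathcal{N}^\perp=\overline{\mathrm{span}}\{e_n^m\otimes\xi:m\ge0,\xi\in\mathcal{E}\}$. $\mathcal{E}_L:=\overline{\mathrm{span}}\{e_1^m\otimes\eta:m\ge0,\eta\in\mathcal{E}\}\ominus\overline{\mathrm{span}}\{e_1^p\otimes L\zeta:p\ge1,\zeta\in\mathcal{E}\}$, where $\mathcal{A}\ominus\mathcal{B}$ means $\mathcal{A}\cap\mathcal{B}^\perp$. *)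

theory Defs
  imports "HOL-Analysis.Analysis"
begin

section \<open>Complex Hilbert spaces\<close>

text \<open>
  A complex inner product space is a real one (hence already normed, metric and topological)
  with a compatible complex scalar multiplication and a Hermitian form, linear in its first
  argument, whose real part is the given real inner product.
\<close>

class complex_inner = real_inner +
  fixes scaleC :: "complex \<Rightarrow> 'a \<Rightarrow> 'a" (infixr "*\<^sub>C" 75)
    and cinner :: "'a \<Rightarrow> 'a \<Rightarrow> complex"
  assumes scaleC_add_right: "a *\<^sub>C (x + y) = a *\<^sub>C x + a *\<^sub>C y"
    and scaleC_add_left: "(a + b) *\<^sub>C x = a *\<^sub>C x + b *\<^sub>C x"
    and scaleC_scaleC: "a *\<^sub>C (b *\<^sub>C x) = (a * b) *\<^sub>C x"
    and scaleR_scaleC: "r *\<^sub>R x = complex_of_real r *\<^sub>C x"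
    and cinner_commute: "cinner x y = cnj (cinner y x)"
    and cinner_add_left: "cinner (x + y) z = cinner x z + cinner y z"
    and cinner_scaleC_left: "cinner (a *\<^sub>C x) y = a * cinner x y"
    and Re_cinner: "Re (cinner x y) = inner x y"

class chilbert_space = complex_inner + complete_space

lemma scaleC_one [simp]: "1 *\<^sub>C (x::'a::complex_inner) = x"
  by (metis of_real_1 scaleR_one scaleR_scaleC)

global_interpretation complex_vector: vector_space "scaleC :: complex \<Rightarrow> 'a \<Rightarrow> 'a::complex_inner"
  by unfold_locales (simp_all add: scaleC_add_right scaleC_add_left scaleC_scaleC)

abbreviation cspan :: "'a::complex_inner set \<Rightarrow> 'a set"
  where "cspan \<equiv> complex_vector.span"

lemma cinner_add_right: "cinner x (y + z) = cinner x y + cinner x (z::'a::complex_inner)"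
  by (metis cinner_add_left cinner_commute complex_cnj_add)

lemma cinner_scaleC_right: "cinner x (a *\<^sub>C y) = cnj a * cinner x (y::'a::complex_inner)"
  by (metis cinner_commute cinner_scaleC_left complex_cnj_mult)

lemma cinner_self: "cinner x x = complex_of_real ((norm (x::'a::complex_inner))\<^sup>2)"
proof -
  have "Im (cinner x x) = 0"
    using arg_cong [OF cinner_commute [of x x], of Im] by simp
  thus ?thesis
    by (simp add: complex_eq_iff Re_cinner power2_norm_eq_inner)
qed

lemma norm_scaleC: "norm (a *\<^sub>C x) = cmod a * norm (x::'a::complex_inner)"
proof -
  have "complex_of_real ((norm (a *\<^sub>C x))\<^sup>2) = (a * cnj a) * cinner x x"
    by (simp add: cinner_self [symmetric] cinner_scaleC_left cinner_scaleC_right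
        del: of_real_power)
  also have "\<dots> = complex_of_real ((cmod a * norm x)\<^sup>2)"
    by (simp add: complex_norm_square [symmetric] cinner_self power_mult_distrib)
  finally have "(norm (a *\<^sub>C x))\<^sup>2 = (cmod a * norm x)\<^sup>2"
    using of_real_eq_iff by blast
  thus ?thesis by (simp add: power2_eq_iff_nonneg)
qed

lemma norm_cinner_le: "cmod (cinner x y) \<le> norm x * norm (y::'a::complex_inner)"
proof (cases "cinner x y = 0")
  case False
  define u where "u = cnj (cinner x y) / complex_of_real (cmod (cinner x y))"
  have u: "cmod u = 1" using False by (simp add: u_def norm_divide)
  have "u * cinner x y = complex_of_real (cmod (cinner x y))"
    using False by (simp add: u_def complex_norm_square [symmetric] mult.commute power2_eq_square)
  hence "cmod (cinner x y) = Re (cinner (u *\<^sub>C x) y)"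
    by (simp add: cinner_scaleC_left)
  also have "\<dots> = inner (u *\<^sub>C x) y" by (rule Re_cinner)
  also have "\<dots> \<le> norm (u *\<^sub>C x) * norm y" by (rule norm_cauchy_schwarz)
  finally show ?thesis by (simp add: norm_scaleC u)
qed simp

instantiation complex :: chilbert_space
begin

definition scaleC_complex :: "complex \<Rightarrow> complex \<Rightarrow> complex"
  where "scaleC_complex a x = a * x"

definition cinner_complex :: "complex \<Rightarrow> complex \<Rightarrow> complex"
  where "cinner_complex x y = x * cnj y"

instance
  by standard (simp_all add: scaleC_complex_def cinner_complex_def inner_complex_def
      algebra_simps scaleR_conv_of_real)

end

section \<open>Operators and subspaces\<close>

definition bounded_clinear :: "('a::complex_inner \<Rightarrow> 'b::complex_inner) \<Rightarrow> bool"
  where "bounded_clinear T \<longleftrightarrow>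
    Vector_Spaces.linear scaleC scaleC T \<and> (\<exists>K. \<forall>x. norm (T x) \<le> norm x * K)"

definition isometric :: "('a::complex_inner \<Rightarrow> 'b::complex_inner) \<Rightarrow> bool"
  where "isometric T \<longleftrightarrow> (\<forall>x. norm (T x) = norm x)"

definition orth :: "'a::complex_inner set \<Rightarrow> 'a set"
  where "orth S = {x. \<forall>y\<in>S. cinner x y = 0}"

definition ominus :: "'a::complex_inner set \<Rightarrow> 'a set \<Rightarrow> 'a set" (infixl "\<ominus>\<^sub>H" 65)
  where "A \<ominus>\<^sub>H B = A \<inter> orth B"

definition proj :: "'a::complex_inner set \<Rightarrow> 'a \<Rightarrow> 'a"
  where "proj S x = (THE y. y \<in> S \<and> x - y \<in> orth S)"

text \<open>
  Operators between closed subspaces \<open>H\<close> and \<open>K\<close> are functions of which only the values on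
  \<open>H\<close> matter. The adjoint of such an operator is meaningful on \<open>K\<close> only; it is the usual one,
  taken with respect to \<open>H\<close> as the domain, and \<open>K\<close> enters solely through the restriction of
  the argument, as in \<open>ker_on K (cadjoint_on H T)\<close>.
\<close>

definition cadjoint_on :: "'a::complex_inner set \<Rightarrow> ('a \<Rightarrow> 'b::complex_inner) \<Rightarrow> 'b \<Rightarrow> 'a"
  where "cadjoint_on H T y = (THE x. x \<in> H \<and> (\<forall>h\<in>H. cinner (T h) y = cinner h x))"

abbreviation cadjoint :: "('a::complex_inner \<Rightarrow> 'b::complex_inner) \<Rightarrow> 'b \<Rightarrow> 'a"
  where "cadjoint \<equiv> cadjoint_on UNIV"

definition ker_on :: "'a set \<Rightarrow> ('a \<Rightarrow> 'b::zero) \<Rightarrow> 'a set"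
  where "ker_on K T = {x \<in> K. T x = 0}"

abbreviation ker :: "('a \<Rightarrow> 'b::zero) \<Rightarrow> 'a set"
  where "ker \<equiv> ker_on UNIV"

section \<open>Square-summable families\<close>

definition square_summable :: "('i \<Rightarrow> 'e::real_normed_vector) \<Rightarrow> bool"
  where "square_summable f \<longleftrightarrow> (\<lambda>i. (norm (f i))\<^sup>2) summable_on UNIV"

typedef (overloaded) ('i, 'e) ell2 = "{f :: 'i \<Rightarrow> 'e::complex_inner. square_summable f}"
  by (rule exI [of _ "\<lambda>_. 0"]) (simp add: square_summable_def)

setup_lifting type_definition_ell2

lemma square_summable_comparison:
  assumes "square_summable f" "\<And>i. norm (g i) \<le> c * norm (f i)"
  shows "square_summable g"
  unfolding square_summable_def
proof (rule summable_on_comparison_test)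
  show "(\<lambda>i. c\<^sup>2 * (norm (f i))\<^sup>2) summable_on UNIV"
    using assms(1) unfolding square_summable_def by (rule summable_on_cmult_right)
  show "(norm (g i))\<^sup>2 \<le> c\<^sup>2 * (norm (f i))\<^sup>2" for i
    using power_mono [OF assms(2), of i 2] by (simp add: power_mult_distrib)
qed simp

lemma square_summable_add:
  assumes "square_summable f" "square_summable g"
  shows "square_summable (\<lambda>i. f i + g i)"
  unfolding square_summable_def
proof (rule summable_on_comparison_test)
  show "(\<lambda>i. 2 * (norm (f i))\<^sup>2 + 2 * (norm (g i))\<^sup>2) summable_on UNIV"
    using assms unfolding square_summable_def
    by (intro summable_on_add summable_on_cmult_right)
  show "(norm (f i + g i))\<^sup>2 \<le> 2 * (norm (f i))\<^sup>2 + 2 * (norm (g i))\<^sup>2" for i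
  proof -
    have "(norm (f i + g i))\<^sup>2 \<le> (norm (f i) + norm (g i))\<^sup>2"
      by (intro power_mono norm_triangle_ineq) simp
    also have "\<dots> \<le> 2 * (norm (f i))\<^sup>2 + 2 * (norm (g i))\<^sup>2"
      using sum_squares_bound [of "norm (f i)" "norm (g i)"] by (simp add: power2_sum)
    finally show ?thesis .
  qed
qed simp

lemma cinner_summable:
  fixes f g :: "'i \<Rightarrow> 'e::complex_inner"
  assumes "square_summable f" "square_summable g"
  shows "(\<lambda>i. cinner (f i) (g i)) summable_on UNIV"
proof (rule abs_summable_summable, rule summable_on_comparison_test)
  show "(\<lambda>i. (norm (f i))\<^sup>2 + (norm (g i))\<^sup>2) summable_on UNIV"
    using assms unfolding square_summable_def by (rule summable_on_add)
  show "cmod (cinner (f i) (g i)) \<le> (norm (f i))\<^sup>2 + (norm (g i))\<^sup>2" for i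
  proof -
    have "0 \<le> norm (f i) * norm (g i)" by simp
    thus ?thesis
      using norm_cinner_le [of "f i" "g i"] sum_squares_bound [of "norm (f i)" "norm (g i)"]
      by linarith
  qed
qed simp

lemma inner_summable:
  fixes f g :: "'i \<Rightarrow> 'e::complex_inner"
  assumes "square_summable f" "square_summable g"
  shows "(\<lambda>i. inner (f i) (g i)) summable_on UNIV"
  using summable_on_Re [OF cinner_summable [OF assms]] by (simp add: Re_cinner)

instantiation ell2 :: (type, complex_inner) complex_inner
begin

lift_definition zero_ell2 :: "('a, 'b) ell2" is "\<lambda>_. 0"
  by (simp add: square_summable_def)

lift_definition plus_ell2 :: "('a, 'b) ell2 \<Rightarrow> ('a, 'b) ell2 \<Rightarrow> ('a, 'b) ell2"
  is "\<lambda>f g i. f i + g i"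
  by (rule square_summable_add)

lift_definition uminus_ell2 :: "('a, 'b) ell2 \<Rightarrow> ('a, 'b) ell2" is "\<lambda>f i. - f i"
  by (simp add: square_summable_def)

lift_definition minus_ell2 :: "('a, 'b) ell2 \<Rightarrow> ('a, 'b) ell2 \<Rightarrow> ('a, 'b) ell2"
  is "\<lambda>f g i. f i - g i"
  using square_summable_add [of _ "\<lambda>i. - _ i"] by (fastforce simp: square_summable_def)

lift_definition scaleR_ell2 :: "real \<Rightarrow> ('a, 'b) ell2 \<Rightarrow> ('a, 'b) ell2"
  is "\<lambda>r f i. r *\<^sub>R f i"
  by (rule square_summable_comparison [where c = "\<bar>_\<bar>"]) auto

lift_definition scaleC_ell2 :: "complex \<Rightarrow> ('a, 'b) ell2 \<Rightarrow> ('a, 'b) ell2"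
  is "\<lambda>a f i. a *\<^sub>C f i"
  by (rule square_summable_comparison [where c = "cmod _"]) (auto simp: norm_scaleC)

lift_definition inner_ell2 :: "('a, 'b) ell2 \<Rightarrow> ('a, 'b) ell2 \<Rightarrow> real"
  is "\<lambda>f g. \<Sum>\<^sub>\<infinity>i. inner (f i) (g i)" .

lift_definition cinner_ell2 :: "('a, 'b) ell2 \<Rightarrow> ('a, 'b) ell2 \<Rightarrow> complex"
  is "\<lambda>f g. \<Sum>\<^sub>\<infinity>i. cinner (f i) (g i)" .

definition norm_ell2 :: "('a, 'b) ell2 \<Rightarrow> real"
  where "norm_ell2 f = sqrt (inner f f)"

definition dist_ell2 :: "('a, 'b) ell2 \<Rightarrow> ('a, 'b) ell2 \<Rightarrow> real"
  where "dist_ell2 f g = norm (f - g)"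

definition sgn_ell2 :: "('a, 'b) ell2 \<Rightarrow> ('a, 'b) ell2"
  where "sgn_ell2 f = inverse (norm f) *\<^sub>R f"

definition uniformity_ell2 :: "(('a, 'b) ell2 \<times> ('a, 'b) ell2) filter"
  where "uniformity_ell2 = (INF e\<in>{0<..}. principal {(x, y). dist x y < e})"

definition open_ell2 :: "('a, 'b) ell2 set \<Rightarrow> bool"
  where "open_ell2 U = (\<forall>x\<in>U. eventually (\<lambda>(x', y). x' = x \<longrightarrow> y \<in> U) uniformity)"

instance
proof
  fix x y z :: "('a, 'b) ell2" and r s :: real and a b :: complex
  show "x + y + z = x + (y + z)" by transfer (simp add: add.assoc)
  show "x + y = y + x" by transfer (simp add: add.commute)
  show "0 + x = x" by transfer simp
  show "- x + x = 0" by transfer simp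
  show "x - y = x + - y" by transfer simp
  show "r *\<^sub>R (x + y) = r *\<^sub>R x + r *\<^sub>R y" by transfer (simp add: scaleR_add_right)
  show "(r + s) *\<^sub>R x = r *\<^sub>R x + s *\<^sub>R x" by transfer (simp add: scaleR_add_left)
  show "r *\<^sub>R s *\<^sub>R x = (r * s) *\<^sub>R x" by transfer simp
  show "1 *\<^sub>R x = x" by transfer simp
  show "sgn x = inverse (norm x) *\<^sub>R x" by (rule sgn_ell2_def)
  show "dist x y = norm (x - y)" by (rule dist_ell2_def)
  show "uniformity = (INF e\<in>{0<..}. principal {(x, y). dist (x::('a, 'b) ell2) y < e})"
    by (rule uniformity_ell2_def)
  show "open U = (\<forall>x\<in>U. \<forall>\<^sub>F (x', y) in uniformity. x' = x \<longrightarrow> y \<in> U)"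
    for U :: "('a, 'b) ell2 set" by (rule open_ell2_def)
  show "inner x y = inner y x" by transfer (simp add: inner_commute)
  show "inner (x + y) z = inner x z + inner y z"
    by transfer (simp add: inner_add_left infsum_add inner_summable)
  show "inner (r *\<^sub>R x) y = r * inner x y"
    by transfer (simp add: infsum_cmult_right')
  show "0 \<le> inner x x" by transfer (simp add: infsum_nonneg)
  show "inner x x = 0 \<longleftrightarrow> x = 0"
  proof
    assume "inner x x = 0"
    thus "x = 0"
    proof transfer
      fix f :: "'a \<Rightarrow> 'b"
      assume f: "square_summable f" and 0: "(\<Sum>\<^sub>\<infinity>i. inner (f i) (f i)) = 0"
      have "inner (f i) (f i) = 0" for i
        by (rule nonneg_infsum_le_0D [where A = UNIV])
          (use 0 inner_summable [OF f f] in auto)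
      thus "f = (\<lambda>_. 0)" by auto
    qed
  qed (transfer, simp)
  show "norm x = sqrt (inner x x)" by (rule norm_ell2_def)
  show "a *\<^sub>C (x + y) = a *\<^sub>C x + a *\<^sub>C y" by transfer (simp add: scaleC_add_right)
  show "(a + b) *\<^sub>C x = a *\<^sub>C x + b *\<^sub>C x" by transfer (simp add: scaleC_add_left)
  show "a *\<^sub>C b *\<^sub>C x = (a * b) *\<^sub>C x" by transfer (simp add: scaleC_scaleC)
  show "r *\<^sub>R x = complex_of_real r *\<^sub>C x" by transfer (simp add: scaleR_scaleC)
  show "cinner x y = cnj (cinner y x)"
    by transfer (simp flip: infsum_cnj cinner_commute)
  show "cinner (x + y) z = cinner x z + cinner y z"
    by transfer (simp add: cinner_add_left infsum_add cinner_summable)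
  show "cinner (a *\<^sub>C x) y = a * cinner x y"
    by transfer (simp add: cinner_scaleC_left infsum_cmult_right')
  show "Re (cinner x y) = inner x y"
    by transfer (simp add: infsum_Re [symmetric] cinner_summable Re_cinner)
qed

end

lemma norm_ell2_le_iff:
  fixes f :: "('i, 'e::complex_inner) ell2"
  assumes "0 \<le> c"
  shows "norm f \<le> c \<longleftrightarrow> (\<forall>F. finite F \<longrightarrow> (\<Sum>i\<in>F. (norm (Rep_ell2 f i))\<^sup>2) \<le> c\<^sup>2)"
proof -
  have s: "(\<lambda>i. (norm (Rep_ell2 f i))\<^sup>2) summable_on UNIV"
    using Rep_ell2 [of f] by (simp add: square_summable_def)
  have "(norm f)\<^sup>2 = (\<Sum>\<^sub>\<infinity>i. (norm (Rep_ell2 f i))\<^sup>2)"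
    by (simp add: power2_norm_eq_inner inner_ell2.rep_eq)
  moreover have "norm f \<le> c \<longleftrightarrow> (norm f)\<^sup>2 \<le> c\<^sup>2"
    using assms by (meson norm_ge_zero power2_le_imp_le power_mono)
  moreover have "(\<Sum>\<^sub>\<infinity>i. (norm (Rep_ell2 f i))\<^sup>2) \<le> c\<^sup>2 \<longleftrightarrow>
      (\<forall>F. finite F \<longrightarrow> (\<Sum>i\<in>F. (norm (Rep_ell2 f i))\<^sup>2) \<le> c\<^sup>2)"
  proof (intro iffI allI impI)
    fix F :: "'i set"
    assume "(\<Sum>\<^sub>\<infinity>i. (norm (Rep_ell2 f i))\<^sup>2) \<le> c\<^sup>2" "finite F"
    thus "(\<Sum>i\<in>F. (norm (Rep_ell2 f i))\<^sup>2) \<le> c\<^sup>2"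
      using finite_sum_le_infsum [OF s, of F] by fastforce
  next
    assume "\<forall>F. finite F \<longrightarrow> (\<Sum>i\<in>F. (norm (Rep_ell2 f i))\<^sup>2) \<le> c\<^sup>2"
    thus "(\<Sum>\<^sub>\<infinity>i. (norm (Rep_ell2 f i))\<^sup>2) \<le> c\<^sup>2"
      by (intro infsum_le_finite_sums s) auto
  qed
  ultimately show ?thesis by simp
qed

lemma norm_Rep_ell2_le: "norm (Rep_ell2 f i) \<le> norm (f::('i, 'e::complex_inner) ell2)"
proof -
  have "(norm (Rep_ell2 f i))\<^sup>2 \<le> (norm f)\<^sup>2"
    using iffD1 [OF norm_ell2_le_iff order_refl, of f, rule_format, of "{i}"] by simp
  thus ?thesis by (rule power2_le_imp_le) simp
qed

instance ell2 :: (type, chilbert_space) chilbert_space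
proof
  fix X :: "nat \<Rightarrow> ('a, 'b) ell2"
  assume X: "Cauchy X"
  have "Cauchy (\<lambda>n. Rep_ell2 (X n) i)" for i
  proof (rule metric_CauchyI)
    fix e :: real assume "0 < e"
    then obtain M where "\<forall>m\<ge>M. \<forall>n\<ge>M. dist (X m) (X n) < e"
      using X metric_CauchyD by blast
    moreover have "dist (Rep_ell2 (X m) i) (Rep_ell2 (X n) i) \<le> dist (X m) (X n)" for m n
      using norm_Rep_ell2_le [of "X m - X n" i] by (simp add: dist_norm minus_ell2.rep_eq)
    ultimately show "\<exists>M. \<forall>m\<ge>M. \<forall>n\<ge>M. dist (Rep_ell2 (X m) i) (Rep_ell2 (X n) i) < e"
      by (meson le_less_trans)
  qed
  hence "\<forall>i. \<exists>l. (\<lambda>n. Rep_ell2 (X n) i) \<longlonglongrightarrow> l"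
    by (simp add: Cauchy_convergent_iff convergent_def)
  then obtain f where f: "\<And>i. (\<lambda>n. Rep_ell2 (X n) i) \<longlonglongrightarrow> f i" by metis
  have bound: "(\<Sum>i\<in>F. (norm (Rep_ell2 (X m) i - f i))\<^sup>2) \<le> e\<^sup>2"
    if "finite F" "0 < e" "\<And>n. n \<ge> M \<Longrightarrow> norm (X m - X n) \<le> e" for e m M F
  proof (rule LIMSEQ_le_const2)
    show "(\<lambda>n. \<Sum>i\<in>F. (norm (Rep_ell2 (X m) i - Rep_ell2 (X n) i))\<^sup>2)
        \<longlonglongrightarrow> (\<Sum>i\<in>F. (norm (Rep_ell2 (X m) i - f i))\<^sup>2)"
      by (intro tendsto_intros f)
    show "\<exists>N. \<forall>n\<ge>N. (\<Sum>i\<in>F. (norm (Rep_ell2 (X m) i - Rep_ell2 (X n) i))\<^sup>2) \<le> e\<^sup>2"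
    proof (intro exI [of _ M] allI impI)
      fix n assume "n \<ge> M"
      hence "(\<Sum>i\<in>F. (norm (Rep_ell2 (X m - X n) i))\<^sup>2) \<le> e\<^sup>2"
        using that norm_ell2_le_iff [of e "X m - X n"] by auto
      thus "(\<Sum>i\<in>F. (norm (Rep_ell2 (X m) i - Rep_ell2 (X n) i))\<^sup>2) \<le> e\<^sup>2"
        by (simp add: minus_ell2.rep_eq)
    qed
  qed
  have ex: "\<exists>M. \<forall>m\<ge>M. \<forall>F. finite F \<longrightarrow> (\<Sum>i\<in>F. (norm (Rep_ell2 (X m) i - f i))\<^sup>2) \<le> e\<^sup>2"
    if e: "0 < e" for e
  proof -
    obtain M where M: "\<forall>m\<ge>M. \<forall>n\<ge>M. dist (X m) (X n) < e"
      using metric_CauchyD [OF X e] by blast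
    show ?thesis
    proof (intro exI [of _ M] allI impI)
      fix m F assume "M \<le> m" "finite (F::'a set)"
      thus "(\<Sum>i\<in>F. (norm (Rep_ell2 (X m) i - f i))\<^sup>2) \<le> e\<^sup>2"
        by (intro bound [of _ _ M]) (use M e in \<open>auto simp: dist_norm less_imp_le\<close>)
    qed
  qed
  obtain M where M: "\<forall>F. finite F \<longrightarrow> (\<Sum>i\<in>F. (norm (Rep_ell2 (X M) i - f i))\<^sup>2) \<le> 1\<^sup>2"
    using ex [of 1] by auto
  have "(\<lambda>i. (norm (Rep_ell2 (X M) i - f i))\<^sup>2) summable_on UNIV"
    by (rule nonneg_bdd_above_summable_on) (use M in \<open>auto intro!: bdd_aboveI2\<close>)
  hence "square_summable (\<lambda>i. f i - Rep_ell2 (X M) i)"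
    by (simp add: square_summable_def norm_minus_commute)
  hence "square_summable (\<lambda>i. (f i - Rep_ell2 (X M) i) + Rep_ell2 (X M) i)"
    using Rep_ell2 [of "X M"] by (intro square_summable_add) auto
  hence sf: "Rep_ell2 (Abs_ell2 f) = f"
    by (simp add: Abs_ell2_inverse)
  have "X \<longlonglongrightarrow> Abs_ell2 f"
  proof (rule metric_LIMSEQ_I)
    fix r :: real assume r: "0 < r"
    then obtain N where "\<forall>m\<ge>N. \<forall>F. finite F \<longrightarrow>
        (\<Sum>i\<in>F. (norm (Rep_ell2 (X m) i - f i))\<^sup>2) \<le> (r/2)\<^sup>2"
      using ex [of "r/2"] by auto
    hence "norm (X m - Abs_ell2 f) \<le> r/2" if "m \<ge> N" for m
      using r that by (subst norm_ell2_le_iff) (simp_all add: minus_ell2.rep_eq sf)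
    thus "\<exists>N. \<forall>m\<ge>N. dist (X m) (Abs_ell2 f) < r"
      using r by (intro exI [of _ N]) (fastforce simp: dist_norm)
  qed
  thus "convergent X" by (auto simp: convergent_def)
qed

section \<open>The full Fock space and its ampliation\<close>

text \<open>
  Letters are the elements of a finite linearly ordered type with \<open>n\<close> elements, its least
  element playing the role of \<open>1\<close> and its greatest that of \<open>n\<close>; being nonempty, it has
  \<open>n \<ge> 1\<close>. Words are lists of letters. The Fock space, having an orthonormal basis indexed by
  the words, is the space of square-summable complex families over words; its Hilbert space
  tensor product with \<open>\<E>\<close> is the space of square-summable \<open>\<E>\<close>-valued families.
  This is justified by \<open>cinner_tensor\<close> and \<open>closure_cspan_tensors\<close>: elementary tensors have the
  right inner products, and they are total.
\<close>

type_synonym ('n, 'e) fock_tensor = "('n list, 'e) ell2"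

lift_definition tensor :: "('i, complex) ell2 \<Rightarrow> 'e::complex_inner \<Rightarrow> ('i, 'e) ell2"
    (infixr "\<otimes>\<^sub>H" 70)
  is "\<lambda>f \<eta> i. f i *\<^sub>C \<eta>"
proof -
  fix f :: "'i \<Rightarrow> complex" and \<eta> :: 'e
  assume "square_summable f"
  thus "square_summable (\<lambda>i. f i *\<^sub>C \<eta>)"
    by (rule square_summable_comparison [where c = "norm \<eta>"]) (simp add: norm_scaleC)
qed

lift_definition basis_vec :: "'i \<Rightarrow> ('i, complex) ell2"
  is "\<lambda>i j. if j = i then 1 else 0"
proof -
  fix i :: 'i
  have "(\<lambda>j. (cmod (if j = i then 1 else 0))\<^sup>2) summable_on UNIV \<longleftrightarrow>
        (\<lambda>j. (cmod (if j = i then 1 else 0))\<^sup>2) summable_on {i}"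
    by (rule summable_on_cong_neutral) auto
  thus "square_summable (\<lambda>j. if j = i then 1 else 0 :: complex)"
    by (simp add: square_summable_def)
qed

lemma cinner_tensor: "cinner (f \<otimes>\<^sub>H \<eta>) (g \<otimes>\<^sub>H \<zeta>) = cinner f g * cinner \<eta> \<zeta>"
proof (transfer fixing: \<eta> \<zeta>)
  fix f g :: "'a \<Rightarrow> complex"
  have "(\<Sum>\<^sub>\<infinity>i. cinner (f i *\<^sub>C \<eta>) (g i *\<^sub>C \<zeta>)) = (\<Sum>\<^sub>\<infinity>i. cinner (f i) (g i) * cinner \<eta> \<zeta>)"
    by (rule infsum_cong) (simp add: cinner_scaleC_left cinner_scaleC_right cinner_complex_def)
  also have "\<dots> = (\<Sum>\<^sub>\<infinity>i. cinner (f i) (g i)) * cinner \<eta> \<zeta>"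
    by (rule infsum_cmult_left')
  finally show "(\<Sum>\<^sub>\<infinity>i. cinner (f i *\<^sub>C \<eta>) (g i *\<^sub>C \<zeta>)) = (\<Sum>\<^sub>\<infinity>i. cinner (f i) (g i)) * cinner \<eta> \<zeta>" .
qed

lemma Rep_ell2_sum: "Rep_ell2 (sum f A) i = (\<Sum>a\<in>A. Rep_ell2 (f a) i)"
  by (induction A rule: infinite_finite_induct)
    (simp_all add: zero_ell2.rep_eq plus_ell2.rep_eq)

lemma closure_cspan_tensors:
  "closure (cspan {basis_vec i \<otimes>\<^sub>H \<eta> | i \<eta>. True}) = (UNIV :: ('i, 'e::complex_inner) ell2 set)"
proof (intro set_eqI iffI UNIV_I)
  fix f :: "('i, 'e) ell2"
  let ?n = "\<lambda>i. (norm (Rep_ell2 f i))\<^sup>2"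
  have s: "?n summable_on UNIV"
    using Rep_ell2 [of f] by (simp add: square_summable_def)
  show "f \<in> closure (cspan {basis_vec i \<otimes>\<^sub>H \<eta> | i \<eta>. True})"
  proof (subst closure_approachable, intro allI impI)
    fix e :: real assume e: "0 < e"
    obtain F where F: "finite F" "dist (sum ?n F) (infsum ?n UNIV) \<le> (e/2)\<^sup>2"
      using infsum_finite_approximation [OF s, of "(e/2)\<^sup>2"] e by auto
    define g where "g = (\<Sum>i\<in>F. basis_vec i \<otimes>\<^sub>H Rep_ell2 f i)"
    have g: "Rep_ell2 g j = (if j \<in> F then Rep_ell2 f j else 0)" for j
    proof -
      have "Rep_ell2 g j = (\<Sum>i\<in>F. if i = j then Rep_ell2 f j else 0)"
        unfolding g_def Rep_ell2_sum tensor.rep_eq basis_vec.rep_eq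
        by (rule sum.cong) auto
      thus ?thesis using F(1) by simp
    qed
    have "(\<Sum>i\<in>G. (norm (Rep_ell2 (g - f) i))\<^sup>2) \<le> (e/2)\<^sup>2" if G: "finite G" for G
    proof -
      have "(\<Sum>i\<in>G. (norm (Rep_ell2 (g - f) i))\<^sup>2) = (\<Sum>i\<in>G - F. ?n i)"
        by (rule sum.mono_neutral_cong_right) (use G in \<open>auto simp: minus_ell2.rep_eq g\<close>)
      moreover have "(\<Sum>i\<in>G - F. ?n i) + sum ?n F = sum ?n (G \<union> F)"
        using G F(1) by (metis Un_Diff_cancel2 finite_Diff sum.union_disjoint Diff_disjoint
            Int_commute)
      moreover have "sum ?n (G \<union> F) \<le> infsum ?n UNIV"
        using G F(1) by (intro finite_sum_le_infsum s) auto
      ultimately show ?thesis using F(2) by (simp add: dist_real_def)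
    qed
    hence "norm (g - f) \<le> e/2"
      using e norm_ell2_le_iff [of "e/2"] by auto
    moreover have "g \<in> cspan {basis_vec i \<otimes>\<^sub>H \<eta> | i \<eta>. True}"
      unfolding g_def by (intro complex_vector.span_sum complex_vector.span_base) auto
    ultimately show "\<exists>y\<in>cspan {basis_vec i \<otimes>\<^sub>H \<eta> | i \<eta>. True}. dist y f < e"
      using e by (intro bexI [of _ g]) (auto simp: dist_norm)
  qed
qed

text \<open>
  Left creation operators. For \<open>'e = complex\<close> this is \<open>S\<^sub>i\<close> on the Fock space itself, in
  general it is \<open>S\<^sub>i \<otimes> I\<close>, by \<open>creation_tensor\<close>.
\<close>

lift_definition creation ::
  "'n \<Rightarrow> ('n, 'e::complex_inner) fock_tensor \<Rightarrow> ('n, 'e) fock_tensor"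
  is "\<lambda>i f \<mu>. case \<mu> of [] \<Rightarrow> 0 | j # \<nu> \<Rightarrow> if j = i then f \<nu> else 0"
proof -
  fix i :: 'n and f :: "'n list \<Rightarrow> 'e"
  let ?g = "\<lambda>\<mu>. case \<mu> of [] \<Rightarrow> 0 | j # \<nu> \<Rightarrow> if j = i then f \<nu> else 0"
  assume "square_summable f"
  hence "((\<lambda>\<mu>. (norm (?g \<mu>))\<^sup>2) \<circ> (#) i) summable_on UNIV"
    by (simp add: square_summable_def o_def)
  hence "(\<lambda>\<mu>. (norm (?g \<mu>))\<^sup>2) summable_on range ((#) i)"
    by (subst summable_on_reindex) auto
  moreover have "(\<lambda>\<mu>. (norm (?g \<mu>))\<^sup>2) summable_on range ((#) i) \<longleftrightarrow>
      (\<lambda>\<mu>. (norm (?g \<mu>))\<^sup>2) summable_on UNIV"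
    by (rule summable_on_cong_neutral) (auto split: list.splits if_splits)
  ultimately show "square_summable ?g" by (simp add: square_summable_def)
qed

lemma creation_basis_vec: "creation i (basis_vec \<mu>) = basis_vec (i # \<mu>)"
  by transfer (auto simp: fun_eq_iff split: list.splits)

lemma creation_tensor: "creation i (f \<otimes>\<^sub>H \<eta>) = creation i f \<otimes>\<^sub>H \<eta>"
  by (rule Rep_ell2_inject [THEN iffD1], rule ext)
    (simp add: creation.rep_eq tensor.rep_eq split: list.split)

section \<open>Odometer maps\<close>

definition first_letter :: "'n::{finite, linorder}"
  where "first_letter = Min UNIV"

definition last_letter :: "'n::{finite, linorder}"
  where "last_letter = Max UNIV"

definition next_letter :: "'n \<Rightarrow> 'n::{finite, linorder}"
  where "next_letter i = Min {j. i < j}"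

text \<open>
  \<open>odometer_map L W\<close> states that \<open>W = W\<^sub>L\<close> and that \<open>W\<^sub>L\<close> is bounded; by totality of the vectors
  \<open>e\<^sub>\<mu> \<otimes> \<eta>\<close> there is at most one such \<open>W\<close>. Positions in words are counted from \<open>0\<close>, so \<open>k\<close> here
  is the \<open>k - 1\<close> of the usual formula.
\<close>

definition odometer_map ::
  "('e::complex_inner \<Rightarrow> ('n::{finite, linorder}, 'e) fock_tensor) \<Rightarrow>
   (('n, 'e) fock_tensor \<Rightarrow> ('n, 'e) fock_tensor) \<Rightarrow> bool"
  where "odometer_map L W \<longleftrightarrow>
    bounded_clinear W \<and>
    (\<forall>\<eta>. W (basis_vec [] \<otimes>\<^sub>H \<eta>) = L \<eta>) \<and>
    (\<forall>m\<ge>1. \<forall>\<eta>. W (basis_vec (replicate m last_letter) \<otimes>\<^sub>H \<eta>) =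
                (creation first_letter ^^ m) (L \<eta>)) \<and>
    (\<forall>\<mu> k \<eta>. k < length \<mu> \<and> \<mu> ! k \<noteq> last_letter \<and> (\<forall>j<k. \<mu> ! j = last_letter) \<longrightarrow>
       W (basis_vec \<mu> \<otimes>\<^sub>H \<eta>) =
       basis_vec (replicate k first_letter @ next_letter (\<mu> ! k) # drop (Suc k) \<mu>) \<otimes>\<^sub>H \<eta>)"

definition M_perp :: "('n::{finite, linorder}, 'e::complex_inner) fock_tensor set"
  where "M_perp = closure (cspan {basis_vec (replicate m first_letter) \<otimes>\<^sub>H \<xi> | m \<xi>. True})"

definition N_perp :: "('n::{finite, linorder}, 'e::complex_inner) fock_tensor set"
  where "N_perp = closure (cspan {basis_vec (replicate m last_letter) \<otimes>\<^sub>H \<xi> | m \<xi>. True})"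

text \<open>The compression of \<open>W\<close>, to be read as an operator from \<open>N_perp\<close> to \<open>M_perp\<close>.\<close>

definition W22 ::
  "(('n::{finite, linorder}, 'e::complex_inner) fock_tensor \<Rightarrow> ('n, 'e) fock_tensor) \<Rightarrow>
   ('n, 'e) fock_tensor \<Rightarrow> ('n, 'e) fock_tensor"
  where "W22 W f = proj M_perp (W f)"

definition E_space ::
  "('e::complex_inner \<Rightarrow> ('n::{finite, linorder}, 'e) fock_tensor) \<Rightarrow> ('n, 'e) fock_tensor set"
  where "E_space L =
    closure (cspan {basis_vec (replicate m first_letter) \<otimes>\<^sub>H \<eta> | m \<eta>. True}) \<ominus>\<^sub>H
    closure (cspan {(creation first_letter ^^ p) (L \<zeta>) | p \<zeta>. p \<ge> 1})"

end

theory Submission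
  imports Defs
begin

text \<open>
  A vector \<open>f\<close> lies in \<open>ker W\<^sup>*\<close> iff it is orthogonal to all \<open>W (e\<^sub>\<mu> \<otimes> \<eta>)\<close>. On words \<open>\<mu>\<close> that are not
  powers of the last letter, \<open>W\<close> acts as a bijection onto the words that are not powers of the
  first letter (odometer addition without overflow), and orthogonality to those tensors says
  exactly that \<open>f \<in> M_perp\<close>. What is left are the words \<open>n\<^sup>m\<close>, whose tensors span \<open>N_perp\<close> and go
  to \<open>(S\<^sub>1)\<^sup>m L \<eta>\<close>; this gives the other three descriptions.
\<close>

section \<open>Projections and adjoints\<close>

text \<open>The parallelogram law makes a sequence in \<open>S\<close> whose distances to
  \<open>x\<close> approach the infimum \<open>d\<close> Cauchy. Its limit is a nearest point, and
  minimality along each line through that point forces orthogonality.\<close>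

lemma exists_projection_real:
  fixes x :: "'a::{real_inner, complete_space}"
  assumes "subspace S" "closed S"
  shows "\<exists>y\<in>S. \<forall>z\<in>S. inner (x - y) z = 0"
proof -
  have ne: "S \<noteq> {}" using subspace_0 [OF assms(1)] by auto
  define d where "d = infdist x S"
  have d0: "0 \<le> d" by (simp add: d_def infdist_nonneg)
  have d: "d \<le> norm (x - y)" if "y \<in> S" for y
    using infdist_le [OF that, of x] by (simp add: d_def dist_norm)
  have near: "\<exists>y\<in>S. norm (x - y) < e" if "d < e" for e
  proof (rule ccontr)
    assume "\<not> ?thesis"
    hence "e \<le> (INF y\<in>S. dist x y)"
      by (intro cINF_greatest [OF ne]) (auto simp: dist_norm not_less)
    thus False using that ne by (simp add: d_def infdist_notempty)
  qed
  \<comment> \<open>The error is measured on squared distances, so that it enters the parallelogram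
    law linearly.\<close>
  have "\<exists>y\<in>S. (norm (x - y))\<^sup>2 < d\<^sup>2 + 1 / real (Suc n)" for n
  proof -
    have "d < sqrt (d\<^sup>2 + 1 / real (Suc n))"
      by (rule real_less_rsqrt) simp
    then obtain y where y: "y \<in> S" "norm (x - y) < sqrt (d\<^sup>2 + 1 / real (Suc n))"
      using near by blast
    hence "(norm (x - y))\<^sup>2 < (sqrt (d\<^sup>2 + 1 / real (Suc n)))\<^sup>2"
      by (intro power_strict_mono) auto
    thus ?thesis using y(1) by (auto simp: add_nonneg_nonneg)
  qed
  then obtain Y where Y: "\<And>n. Y n \<in> S" "\<And>n. (norm (x - Y n))\<^sup>2 < d\<^sup>2 + 1 / real (Suc n)"
    by metis
  have gap: "(norm (Y m - Y n))\<^sup>2 \<le> 2 / real (Suc m) + 2 / real (Suc n)" for m n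
  proof -
    \<comment> \<open>The midpoint is again in \<open>S\<close>, hence at distance at least
      \<open>d\<close>. In the parallelogram identity below this cancels the \<open>d\<close> terms
      and leaves only the errors.\<close>
    have "(1/2) *\<^sub>R (Y m + Y n) \<in> S"
      using assms(1) Y(1) by (simp add: subspace_add subspace_scale)
    hence "d\<^sup>2 \<le> (norm (x - (1/2) *\<^sub>R (Y m + Y n)))\<^sup>2"
      using d d0 power_mono by blast
    moreover have "(norm (Y m - Y n))\<^sup>2 + 4 * (norm (x - (1/2) *\<^sub>R (Y m + Y n)))\<^sup>2 =
        2 * (norm (x - Y m))\<^sup>2 + 2 * (norm (x - Y n))\<^sup>2"
      by (simp add: power2_norm_eq_inner inner_diff_left inner_diff_right inner_add_left
          inner_add_right inner_commute algebra_simps)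
    ultimately show ?thesis using Y(2) [of m] Y(2) [of n] by simp
  qed
  have "Cauchy Y"
  proof (rule metric_CauchyI)
    fix e :: real assume e: "0 < e"
    obtain N where N: "inverse (real (Suc N)) < e\<^sup>2 / 4"
      using reals_Archimedean [of "e\<^sup>2 / 4"] e by auto
    have "dist (Y m) (Y n) < e" if "N \<le> m" "N \<le> n" for m n
    proof -
      have "1 / real (Suc m) \<le> inverse (real (Suc N))" "1 / real (Suc n) \<le> inverse (real (Suc N))"
        using that by (simp_all add: field_simps)
      hence "(norm (Y m - Y n))\<^sup>2 < e\<^sup>2" using gap [of m n] N by simp
      thus ?thesis using e by (simp add: dist_norm power_less_imp_less_base)
    qed
    thus "\<exists>M. \<forall>m\<ge>M. \<forall>n\<ge>M. dist (Y m) (Y n) < e" by blast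
  qed
  then obtain y where lim: "Y \<longlonglongrightarrow> y"
    by (auto simp: Cauchy_convergent_iff convergent_def)
  have yS: "y \<in> S"
    using closed_sequentially [OF assms(2) _ lim] Y(1) by blast
  have lim_norm: "(\<lambda>n. (norm (x - Y n))\<^sup>2) \<longlonglongrightarrow> (norm (x - y))\<^sup>2"
    by (intro tendsto_intros lim)
  have "(\<lambda>n. d\<^sup>2 + 1 / real (Suc n)) \<longlonglongrightarrow> d\<^sup>2 + 0"
    by (intro tendsto_intros LIMSEQ_Suc lim_1_over_n)
  hence min: "(norm (x - y))\<^sup>2 \<le> d\<^sup>2"
    using LIMSEQ_le [OF lim_norm _ exI [of _ 0], of "\<lambda>n. d\<^sup>2 + 1 / real (Suc n)"]
      less_imp_le [OF Y(2)] by simp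
  have "inner (x - y) z = 0" if z: "z \<in> S" for z
  proof (cases "z = 0")
    case False
    \<comment> \<open>This \<open>t\<close> minimises the quadratic
      \<open>norm ((x - y) - t *\<^sub>R z)\<close> squared. The decrease it achieves must vanish
      because \<open>y\<close> is already optimal.\<close>
    define t where "t = inner (x - y) z / inner z z"
    have "y + t *\<^sub>R z \<in> S" using assms(1) yS z by (simp add: subspace_add subspace_scale)
    hence "d\<^sup>2 \<le> (norm (x - (y + t *\<^sub>R z)))\<^sup>2"
      using d d0 power_mono by blast
    hence "(norm (x - y))\<^sup>2 \<le> (norm ((x - y) - t *\<^sub>R z))\<^sup>2"
      using min unfolding diff_diff_eq by (rule order_trans [rotated])
    also have "\<dots> = (norm (x - y))\<^sup>2 - 2 * t * inner (x - y) z + t\<^sup>2 * inner z z"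
      unfolding power2_norm_eq_inner
      by (simp add: inner_diff_left [of "x - y"] inner_diff_right [of _ "x - y"] inner_commute
          algebra_simps power2_eq_square)
    also have "\<dots> = (norm (x - y))\<^sup>2 - (inner (x - y) z)\<^sup>2 / inner z z"
      using False by (simp add: t_def field_simps power2_eq_square)
    finally have "(inner (x - y) z)\<^sup>2 / inner z z \<le> 0" by simp
    thus ?thesis using False
      by (simp add: divide_le_0_iff) (metis inner_gt_zero_iff not_le)
  qed simp
  thus ?thesis using yS by blast
qed

section \<open>Rules for the complex inner product\<close>

lemma cinner_diff_left: "cinner (x - y) z = cinner x z - cinner y (z::'a::complex_inner)"
  by (metis add_diff_cancel cinner_add_left diff_add_cancel)

lemma cinner_diff_right: "cinner z (x - y) = cinner z x - cinner z (y::'a::complex_inner)"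
  by (metis add_diff_cancel cinner_add_right diff_add_cancel)

lemma cinner_zero_left [simp]: "cinner 0 (x::'a::complex_inner) = 0"
  using cinner_add_left [of 0 0 x] by simp

lemma cinner_zero_right [simp]: "cinner (x::'a::complex_inner) 0 = 0"
  using cinner_add_right [of x 0 0] by simp

lemma cinner_eq_zero_commute: "cinner x y = 0 \<longleftrightarrow> cinner y (x::'a::complex_inner) = 0"
  by (metis cinner_commute complex_cnj_zero)

lemma cinner_self_eq_zero: "cinner x x = 0 \<longleftrightarrow> (x::'a::complex_inner) = 0"
  by (simp add: cinner_self)

lemma bounded_linear_cinner_left: "bounded_linear (\<lambda>x. cinner x (y::'a::complex_inner))"
proof (rule bounded_linear_intro [where K = "norm y"])
  show "cinner (r *\<^sub>R x) y = r *\<^sub>R cinner x y" for r x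
    by (simp only: scaleR_scaleC cinner_scaleC_left scaleC_complex_def)
qed (simp_all add: cinner_add_left norm_cinner_le)

lemma bounded_linear_scaleC: "bounded_linear (scaleC a :: 'a::complex_inner \<Rightarrow> 'a)"
  by (rule bounded_linear_intro [where K = "cmod a"])
    (simp_all add: scaleC_add_right scaleR_scaleC scaleC_scaleC norm_scaleC mult.commute)

section \<open>Complex subspaces, orthogonal complements and projections\<close>

lemma csubspace_imp_subspace: "complex_vector.subspace S \<Longrightarrow> subspace S"
  by (simp add: subspace_def complex_vector.subspace_def scaleR_scaleC)

lemma csubspace_closure:
  fixes S :: "'a::complex_inner set"
  assumes "complex_vector.subspace S"
  shows "complex_vector.subspace (closure S)"
proof (rule complex_vector.subspaceI)
  show "0 \<in> closure S"
    using assms closure_subset complex_vector.subspace_0 by blast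
  show "x + y \<in> closure S" if x: "x \<in> closure S" and y: "y \<in> closure S" for x y
  proof -
    obtain X where X: "\<And>n. X n \<in> S" "X \<longlonglongrightarrow> x"
      using x closure_sequential by blast
    obtain Y where Y: "\<And>n. Y n \<in> S" "Y \<longlonglongrightarrow> y"
      using y closure_sequential by blast
    show ?thesis unfolding closure_sequential
      by (intro exI [of _ "\<lambda>n. X n + Y n"] conjI allI tendsto_add
          complex_vector.subspace_add [OF assms] X Y)
  qed
  show "a *\<^sub>C x \<in> closure S" if x: "x \<in> closure S" for a x
  proof -
    obtain X where X: "\<And>n. X n \<in> S" "X \<longlonglongrightarrow> x"
      using x closure_sequential by blast
    show ?thesis unfolding closure_sequential
      by (intro exI [of _ "\<lambda>n. a *\<^sub>C X n"] conjI allI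
          bounded_linear.tendsto [OF bounded_linear_scaleC]
          complex_vector.subspace_scale [OF assms] X)
  qed
qed

lemma csubspace_orth: "complex_vector.subspace (orth S)"
  by (rule complex_vector.subspaceI) (auto simp: orth_def cinner_add_left cinner_scaleC_left)

lemma closed_orth: "closed (orth (S :: 'a::complex_inner set))"
proof -
  have "orth S = (\<Inter>y\<in>S. {x. cinner x y = 0})"
    by (auto simp: orth_def)
  thus ?thesis
    by (auto intro!: closed_INT closed_Collect_eq continuous_intros
        linear_continuous_on bounded_linear_cinner_left)
qed

text \<open>For fixed \<open>x\<close> the set \<open>orth {x}\<close> is a closed complex subspace,
  so it contains the closed span of \<open>A\<close> once it contains \<open>A\<close>.
  Orthogonality to a closed span thus only needs testing on generators.\<close>

lemma orth_closure_cspan: "orth (closure (cspan A)) = orth (A :: 'a::complex_inner set)"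
proof
  show "orth (closure (cspan A)) \<subseteq> orth A"
    unfolding orth_def using closure_subset complex_vector.span_base by blast
  show "orth A \<subseteq> orth (closure (cspan A))"
  proof
    fix x assume "x \<in> orth A"
    hence "A \<subseteq> orth {x}"
      by (auto simp: orth_def intro: cinner_eq_zero_commute [THEN iffD1])
    hence "closure (cspan A) \<subseteq> orth {x}"
      by (intro closure_minimal complex_vector.span_minimal csubspace_orth closed_orth)
    thus "x \<in> orth (closure (cspan A))"
      by (auto simp: orth_def intro: cinner_eq_zero_commute [THEN iffD1])
  qed
qed

lemma exists_projection:
  fixes x :: "'a::chilbert_space"
  assumes "complex_vector.subspace S" "closed S"
  shows "\<exists>y\<in>S. x - y \<in> orth S"
proof -
  obtain y where y: "y \<in> S" "\<And>z. z \<in> S \<Longrightarrow> inner (x - y) z = 0"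
    using exists_projection_real [OF csubspace_imp_subspace [OF assms(1)] assms(2)] by blast
  have "cinner (x - y) z = 0" if "z \<in> S" for z
  proof (rule complex_eqI)
    show "Re (cinner (x - y) z) = Re 0"
      using y(2) [OF that] by (simp add: Re_cinner)
    \<comment> \<open>The real projection controls only real parts. Since the form is conjugate
      linear on the right, testing against \<open>\<i> *\<^sub>C z\<close> yields the imaginary
      part.\<close>
    have "Re (cinner (x - y) (\<i> *\<^sub>C z)) = 0"
      using y(2) complex_vector.subspace_scale [OF assms(1) that] by (simp only: Re_cinner)
    thus "Im (cinner (x - y) z) = Im 0"
      by (simp add: cinner_scaleC_right)
  qed
  thus ?thesis using y(1) by (auto simp: orth_def)
qed

lemma projection_unique:
  assumes S: "complex_vector.subspace S"
    and "y \<in> S" "x - y \<in> orth S" "z \<in> S" "x - z \<in> orth S"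
  shows "y = z"
proof -
  have "y - z \<in> S" using assms by (simp add: complex_vector.subspace_diff)
  moreover have "(x - z) - (x - y) \<in> orth S"
    using assms csubspace_orth complex_vector.subspace_diff by blast
  ultimately have "cinner (y - z) (y - z) = 0" by (simp add: orth_def)
  thus ?thesis by (simp add: cinner_self_eq_zero)
qed

lemma proj:
  fixes x :: "'a::chilbert_space"
  assumes "complex_vector.subspace S" "closed S"
  shows "proj S x \<in> S" "x - proj S x \<in> orth S"
proof -
  have "\<exists>!y. y \<in> S \<and> x - y \<in> orth S"
    using exists_projection [OF assms] projection_unique [OF assms(1)] by blast
  from theI' [OF this] show "proj S x \<in> S" "x - proj S x \<in> orth S"
    by (simp_all add: proj_def)
qed

text \<open>For the harder inclusion let \<open>y\<close> be the projection of \<open>x\<close> onto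
  the closed span. Then \<open>x - y\<close> is in \<open>orth A\<close>, while \<open>x\<close> and
  \<open>y\<close> are both orthogonal to \<open>orth A\<close>, so \<open>x - y\<close> is
  orthogonal to itself.\<close>

lemma closure_cspan_eq_orth_orth:
  "closure (cspan A) = orth (orth (A :: 'a::chilbert_space set))"
proof
  show "closure (cspan A) \<subseteq> orth (orth A)"
    by (intro closure_minimal complex_vector.span_minimal csubspace_orth closed_orth)
      (auto simp: orth_def intro: cinner_eq_zero_commute [THEN iffD1])
  show "orth (orth A) \<subseteq> closure (cspan A)"
  proof
    fix x assume x: "x \<in> orth (orth A)"
    obtain y where y: "y \<in> closure (cspan A)" "x - y \<in> orth A"
      using exists_projection [of "closure (cspan A)" x] csubspace_closure
      by (auto simp: orth_closure_cspan)
    have "y \<in> orth (orth A)"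
      using y(1) orth_closure_cspan [of A] by (auto simp: orth_def intro: cinner_eq_zero_commute [THEN iffD1])
    hence "cinner (x - y) (x - y) = 0"
      using x y(2) by (auto simp: orth_def cinner_diff_left)
    thus "x \<in> closure (cspan A)" using y(1) by (simp add: cinner_self_eq_zero)
  qed
qed

section \<open>Riesz representation and adjoints\<close>

text \<open>The kernel of a nonzero bounded functional is a closed hyperplane. The component
  \<open>w\<close> orthogonal to it, of a vector \<open>u\<close> outside it, spans the rest, and a
  multiple of \<open>w\<close> represents the functional.\<close>

lemma riesz_representation:
  fixes \<phi> :: "'a::chilbert_space \<Rightarrow> complex"
  assumes lin: "Vector_Spaces.linear scaleC scaleC \<phi>" and bnd: "\<And>x. cmod (\<phi> x) \<le> norm x * K"
  shows "\<exists>y. \<forall>x. \<phi> x = cinner x y"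
proof (cases "\<forall>x. \<phi> x = 0")
  case True
  thus ?thesis by (intro exI [of _ 0]) simp
next
  case False
  interpret \<phi>: Vector_Spaces.linear scaleC scaleC \<phi> by (fact lin)
  have add: "\<phi> (x + y) = \<phi> x + \<phi> y" and scale: "\<phi> (a *\<^sub>C x) = a * \<phi> x"
    and diff: "\<phi> (x - y) = \<phi> x - \<phi> y" for a x y
    by (simp_all add: \<phi>.add \<phi>.scale \<phi>.diff scaleC_complex_def)
  have "bounded_linear \<phi>"
  proof (rule bounded_linear_intro [where K = K])
    show "\<phi> (r *\<^sub>R x) = r *\<^sub>R \<phi> x" for r x
      by (simp only: scaleR_scaleC scale scaleC_complex_def)
  qed (simp_all add: add bnd)
  hence closed: "closed {x. \<phi> x = 0}"
    by (intro closed_Collect_eq continuous_intros linear_continuous_on)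
  have sub: "complex_vector.subspace {x. \<phi> x = 0}"
    by (rule complex_vector.subspaceI) (simp_all add: add scale \<phi>.zero)
  obtain u where u: "\<phi> u \<noteq> 0" using False by blast
  obtain v where v: "\<phi> v = 0" "u - v \<in> orth {x. \<phi> x = 0}"
    using exists_projection [OF sub closed, of u] by blast
  define w where "w = u - v"
  have w: "\<phi> w = \<phi> u" "w \<noteq> 0" using u v(1) by (auto simp: w_def diff)
  define c where "c = cinner w w"
  have c: "c \<noteq> 0" by (simp add: c_def cinner_self_eq_zero w(2))
  have "\<phi> x = cinner x (cnj (\<phi> u / c) *\<^sub>C w)" for x
  proof -
    \<comment> \<open>Because \<open>\<phi> w = \<phi> u\<close>, subtracting this multiple of
      \<open>w\<close> moves \<open>x\<close> into the kernel, to which \<open>w\<close> is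
      orthogonal.\<close>
    have "\<phi> (x - (\<phi> x / \<phi> u) *\<^sub>C w) = 0"
      using u by (simp add: diff scale w(1))
    hence "cinner w (x - (\<phi> x / \<phi> u) *\<^sub>C w) = 0"
      using v(2) by (simp add: orth_def w_def)
    hence "cinner (x - (\<phi> x / \<phi> u) *\<^sub>C w) w = 0"
      by (simp only: cinner_eq_zero_commute)
    hence "cinner x w = \<phi> x / \<phi> u * c"
      by (simp add: cinner_diff_left cinner_scaleC_left c_def)
    thus ?thesis using u c by (simp add: cinner_scaleC_right)
  qed
  thus ?thesis by blast
qed

text \<open>Two candidates in \<open>H\<close> differ by a vector of \<open>H\<close> that is
  orthogonal to \<open>H\<close>, so the definite description has at most one solution. It can be
  evaluated by exhibiting one.\<close>

lemma cadjoint_on_eqI: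
  assumes "complex_vector.subspace H" "x \<in> H" "\<And>h. h \<in> H \<Longrightarrow> cinner (T h) y = cinner h x"
  shows "cadjoint_on H T y = x"
  unfolding cadjoint_on_def
proof (rule the_equality)
  fix z assume z: "z \<in> H \<and> (\<forall>h\<in>H. cinner (T h) y = cinner h z)"
  hence "z - x \<in> H" using assms by (simp add: complex_vector.subspace_diff)
  hence "cinner (z - x) (z - x) = 0" using z assms(3) by (metis cinner_diff_right diff_self)
  thus "z = x" by (simp add: cinner_self_eq_zero)
qed (use assms in auto)

text \<open>Riesz representation of the functional sending \<open>h\<close> to
  \<open>cinner (T h) y\<close> supplies the vector that the definite description asks for.\<close>

lemma cinner_cadjoint:
  fixes T :: "'a::chilbert_space \<Rightarrow> 'b::complex_inner"
  assumes "bounded_clinear T"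
  shows "cinner (T h) y = cinner h (cadjoint T y)"
proof -
  obtain K where K: "\<And>x. norm (T x) \<le> norm x * K"
    and lin: "Vector_Spaces.linear scaleC scaleC T"
    using assms by (auto simp: bounded_clinear_def)
  interpret T: Vector_Spaces.linear scaleC scaleC T by (fact lin)
  have "\<exists>x. \<forall>h. cinner (T h) y = cinner h x"
  proof (rule riesz_representation)
    show "Vector_Spaces.linear scaleC scaleC (\<lambda>h. cinner (T h) y)"
      by unfold_locales
        (simp_all add: T.add T.scale cinner_add_left cinner_scaleC_left scaleC_complex_def
          algebra_simps)
    show "cmod (cinner (T h) y) \<le> norm h * (K * norm y)" for h
      using norm_cinner_le [of "T h" y] mult_right_mono [OF K [of h], of "norm y"]
      by (simp add: mult.assoc)
  qed
  then obtain x where x: "\<And>h. cinner (T h) y = cinner h x" by blast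
  hence "cadjoint T y = x"
    by (intro cadjoint_on_eqI) simp_all
  thus ?thesis by (simp add: x)
qed

lemma cadjoint_eq_zero_iff:
  fixes T :: "'a::chilbert_space \<Rightarrow> 'b::complex_inner"
  assumes "bounded_clinear T"
  shows "cadjoint T y = 0 \<longleftrightarrow> (\<forall>h. cinner (T h) y = 0)"
  using cinner_cadjoint [OF assms, of _ y] cinner_self_eq_zero by fastforce

section \<open>Tensors in the Fock space\<close>

lemma cinner_basis_tensor:
  fixes f :: "('i, 'e::complex_inner) ell2"
  shows "cinner (basis_vec i \<otimes>\<^sub>H \<eta>) f = cinner \<eta> (Rep_ell2 f i)"
proof -
  have "cinner (basis_vec i \<otimes>\<^sub>H \<eta>) f =
      (\<Sum>\<^sub>\<infinity>j. cinner ((if j = i then 1 else 0) *\<^sub>C \<eta>) (Rep_ell2 f j))"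
    by (simp add: cinner_ell2.rep_eq tensor.rep_eq basis_vec.rep_eq)
  also have "\<dots> = (\<Sum>\<^sub>\<infinity>j\<in>{i}. cinner ((if j = i then 1 else 0) *\<^sub>C \<eta>) (Rep_ell2 f j))"
    by (rule infsum_cong_neutral) auto
  finally show ?thesis by simp
qed

text \<open>The closed span consists of the families supported on \<open>range w\<close>. By the
  double complement it suffices to pair \<open>f\<close> with \<open>g\<close> orthogonal to the
  generators: \<open>g\<close> vanishes on \<open>range w\<close> and \<open>f\<close> off it, so
  every term of the pairing is zero.\<close>

lemma mem_closure_cspan_basis_tensors:
  fixes f :: "('i, 'e::chilbert_space) ell2"
  shows "f \<in> closure (cspan {basis_vec (w m) \<otimes>\<^sub>H \<eta> | m \<eta>. True}) \<longleftrightarrow>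
    (\<forall>i \<eta>. i \<notin> range w \<longrightarrow> cinner (basis_vec i \<otimes>\<^sub>H \<eta>) f = 0)"
    (is "f \<in> closure (cspan ?A) \<longleftrightarrow> _")
proof
  assume f: "f \<in> closure (cspan ?A)"
  have "basis_vec i \<otimes>\<^sub>H \<eta> \<in> orth ?A" if "i \<notin> range w" for i and \<eta> :: 'e
    using that by (auto simp: orth_def cinner_basis_tensor tensor.rep_eq basis_vec.rep_eq)
  thus "\<forall>i \<eta>. i \<notin> range w \<longrightarrow> cinner (basis_vec i \<otimes>\<^sub>H \<eta>) f = 0"
    using f orth_closure_cspan [of ?A] unfolding orth_def by blast
next
  assume f: "\<forall>i \<eta>. i \<notin> range w \<longrightarrow> cinner (basis_vec i \<otimes>\<^sub>H \<eta>) f = 0"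
  have "f \<in> orth (orth ?A)"
    unfolding orth_def [of "orth ?A"]
  proof (intro CollectI ballI)
    fix g assume g: "g \<in> orth ?A"
    have "cinner (Rep_ell2 f i) (Rep_ell2 g i) = 0" for i
    proof (cases "i \<in> range w")
      case True
      \<comment> \<open>Choosing the coordinate of \<open>g\<close> itself as the second tensor
        factor turns orthogonality into a zero norm.\<close>
      hence "cinner g (basis_vec i \<otimes>\<^sub>H Rep_ell2 g i) = 0"
        using g by (auto simp: orth_def)
      hence "cinner (basis_vec i \<otimes>\<^sub>H Rep_ell2 g i) g = 0"
        by (simp only: cinner_eq_zero_commute)
      thus ?thesis by (simp add: cinner_basis_tensor cinner_self_eq_zero)
    next
      case False
      hence "cinner (basis_vec i \<otimes>\<^sub>H Rep_ell2 f i) f = 0"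
        using f by blast
      thus ?thesis by (simp add: cinner_basis_tensor cinner_self_eq_zero)
    qed
    thus "cinner f g = 0" by (simp add: cinner_ell2.rep_eq)
  qed
  thus "f \<in> closure (cspan ?A)" by (simp add: closure_cspan_eq_orth_orth)
qed

lemma bounded_clinear_creation:
  "bounded_clinear (creation i :: ('n, 'e::complex_inner) fock_tensor \<Rightarrow> _)"
proof -
  have norm: "norm (creation i f) \<le> norm f" for f :: "('n, 'e) fock_tensor"
  proof (subst norm_ell2_le_iff, simp, intro allI impI)
    fix F :: "'n list set" assume F: "finite F"
    \<comment> \<open>Only words beginning with \<open>i\<close> contribute to the sum; dropping
      that letter reindexes it injectively by coordinates of \<open>f\<close>.\<close>
    have inj: "inj_on tl (F \<inter> range ((#) i))"
      by (auto intro: inj_onI)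
    have "(\<Sum>\<mu>\<in>F. (norm (Rep_ell2 (creation i f) \<mu>))\<^sup>2) =
        (\<Sum>\<mu>\<in>F \<inter> range ((#) i). (norm (Rep_ell2 f (tl \<mu>)))\<^sup>2)"
      by (rule sum.mono_neutral_cong_right)
        (use F in \<open>auto simp: creation.rep_eq split: list.splits if_splits\<close>)
    also have "\<dots> = (\<Sum>\<nu>\<in>tl ` (F \<inter> range ((#) i)). (norm (Rep_ell2 f \<nu>))\<^sup>2)"
      by (simp add: sum.reindex [OF inj])
    also have "\<dots> \<le> (norm f)\<^sup>2"
      using F norm_ell2_le_iff [of "norm f" f] by auto
    finally show "(\<Sum>\<mu>\<in>F. (norm (Rep_ell2 (creation i f) \<mu>))\<^sup>2) \<le> (norm f)\<^sup>2" .
  qed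
  have "Vector_Spaces.linear scaleC scaleC (creation i :: ('n, 'e) fock_tensor \<Rightarrow> _)"
    by unfold_locales
      (simp_all add: Rep_ell2_inject [symmetric] fun_eq_iff creation.rep_eq plus_ell2.rep_eq
        scaleC_ell2.rep_eq scaleC_add_right scaleC_add_left scaleC_scaleC split: list.split)
  thus ?thesis
    unfolding bounded_clinear_def using norm by (auto intro!: exI [of _ 1])
qed

lemma cinner_creation_funpow:
  fixes f g :: "('n, 'e::chilbert_space) fock_tensor"
  shows "cinner ((creation i ^^ p) g) f = cinner g ((cadjoint (creation i) ^^ p) f)"
\<comment> \<open>Moving the outermost factor across replaces \<open>f\<close> by its image under
  the adjoint, so the hypothesis is needed for all \<open>f\<close>.\<close>
proof (induction p arbitrary: f)
  case (Suc p)
  thus ?case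
    by (simp add: cinner_cadjoint [OF bounded_clinear_creation])
      (simp add: funpow_swap1 [of "cadjoint (creation i)"])
qed simp

section \<open>The odometer map on words\<close>

lemma less_next_letter:
  assumes "i \<noteq> last_letter"
  shows "i < next_letter i"
proof -
  have "i < last_letter"
    using assms by (simp add: last_letter_def order.strict_iff_order)
  hence "Min {j. i < j} \<in> {j. i < j}" by (intro Min_in) auto
  thus ?thesis by (simp add: next_letter_def)
qed

lemma next_letter_surj:
  assumes "j \<noteq> first_letter"
  obtains i where "i \<noteq> last_letter" "next_letter i = j"
proof
  have "first_letter < j"
    using assms by (simp add: first_letter_def order.strict_iff_order)
  \<comment> \<open>The preimage is the immediate predecessor of \<open>j\<close>; the set is
    nonempty because it contains \<open>first_letter\<close>.\<close>
  hence "Max {i. i < j} \<in> {i. i < j}" by (intro Max_in) auto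
  hence lt: "Max {i. i < j} < j" by simp
  thus "Max {i. i < j} \<noteq> last_letter"
    unfolding last_letter_def by (metis Max_ge UNIV_I finite not_le)
  show "next_letter (Max {i. i < j}) = j"
    unfolding next_letter_def
  proof (rule Min_eqI)
    fix k assume "k \<in> {k. Max {i. i < j} < k}"
    moreover have "k \<le> Max {i. i < j}" if "k < j"
      using that by (intro Max_ge) auto
    ultimately show "j \<le> k" by fastforce
  qed (use lt in auto)
qed

lemma not_replicate_obtain_index:
  assumes "\<mu> \<notin> range (\<lambda>m. replicate m c)"
  obtains k where "k < length \<mu>" "\<mu> ! k \<noteq> c" "\<And>j. j < k \<Longrightarrow> \<mu> ! j = c"
proof -
  let ?P = "\<lambda>k. k < length \<mu> \<and> \<mu> ! k \<noteq> c"
  have "\<mu> \<noteq> replicate (length \<mu>) c" using assms by blast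
  hence ex: "\<exists>k. ?P k" by (auto simp: list_eq_iff_nth_eq)
  have "?P (LEAST k. ?P k)" using LeastI_ex [OF ex] .
  moreover have "\<mu> ! j = c" if "j < (LEAST k. ?P k)" for j
    using not_less_Least [OF that] that calculation by auto
  ultimately show thesis using that by blast
qed

text \<open>The letter written at position \<open>k\<close> exceeds another letter, so it is not
  \<open>first_letter\<close> and the new word is no power of that letter.\<close>

lemma odometer_map_basis_outside:
  fixes L :: "'e::complex_inner \<Rightarrow> ('n::{finite, linorder}, 'e) fock_tensor"
  assumes "odometer_map L W" "\<mu> \<notin> range (\<lambda>m. replicate m last_letter)"
  obtains \<nu> where "\<nu> \<notin> range (\<lambda>m. replicate m first_letter)"
    "\<And>\<eta>. W (basis_vec \<mu> \<otimes>\<^sub>H \<eta>) = basis_vec \<nu> \<otimes>\<^sub>H \<eta>"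
proof -
  obtain k where k: "k < length \<mu>" "\<mu> ! k \<noteq> last_letter" "\<And>j. j < k \<Longrightarrow> \<mu> ! j = last_letter"
    using not_replicate_obtain_index [OF assms(2)] by blast
  define \<nu> where "\<nu> = replicate k first_letter @ next_letter (\<mu> ! k) # drop (Suc k) \<mu>"
  have "next_letter (\<mu> ! k) \<noteq> first_letter"
    using less_next_letter [OF k(2)] by (metis Min_le UNIV_I finite first_letter_def not_le)
  hence "\<nu> \<notin> range (\<lambda>m. replicate m first_letter)"
    by (metis \<nu>_def imageE in_set_conv_decomp in_set_replicate)
  moreover have "W (basis_vec \<mu> \<otimes>\<^sub>H \<eta>) = basis_vec \<nu> \<otimes>\<^sub>H \<eta>" for \<eta>
    using assms(1) k by (simp add: odometer_map_def \<nu>_def)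
  ultimately show thesis using that by blast
qed

text \<open>Odometer addition is undone by borrowing: the leading first letters become last letters
  and the first other letter steps down to its predecessor.\<close>

lemma odometer_map_onto_outside:
  fixes L :: "'e::complex_inner \<Rightarrow> ('n::{finite, linorder}, 'e) fock_tensor"
  assumes "odometer_map L W" "\<nu> \<notin> range (\<lambda>m. replicate m first_letter)"
  obtains \<mu> where "\<And>\<eta>. W (basis_vec \<mu> \<otimes>\<^sub>H \<eta>) = basis_vec \<nu> \<otimes>\<^sub>H \<eta>"
proof -
  obtain k where k: "k < length \<nu>" "\<nu> ! k \<noteq> first_letter" "\<And>j. j < k \<Longrightarrow> \<nu> ! j = first_letter"
    using not_replicate_obtain_index [OF assms(2)] by blast
  obtain i where i: "i \<noteq> last_letter" "next_letter i = \<nu> ! k"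
    using next_letter_surj [OF k(2)] by blast
  define \<mu> where "\<mu> = replicate k last_letter @ i # drop (Suc k) \<nu>"
  have "take k \<nu> = replicate k first_letter"
    using k(1,3) by (auto simp: list_eq_iff_nth_eq)
  hence "\<nu> = replicate k first_letter @ next_letter (\<mu> ! k) # drop (Suc k) \<mu>"
    using id_take_nth_drop [OF k(1)] by (simp add: \<mu>_def i nth_append)
  moreover have "k < length \<mu>" "\<mu> ! k \<noteq> last_letter" "\<forall>j<k. \<mu> ! j = last_letter"
    by (auto simp: \<mu>_def i nth_append)
  ultimately have "W (basis_vec \<mu> \<otimes>\<^sub>H \<eta>) = basis_vec \<nu> \<otimes>\<^sub>H \<eta>" for \<eta>
    using assms(1) unfolding odometer_map_def by metis
  thus thesis using that by blast
qed

text \<open>Joins the clause for the empty word, where \<open>m = 0\<close>, to the overflow clause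
  for \<open>m \<ge> 1\<close>.\<close>

lemma odometer_map_last_power:
  assumes "odometer_map L W"
  shows "W (basis_vec (replicate m last_letter) \<otimes>\<^sub>H \<eta>) = (creation first_letter ^^ m) (L \<eta>)"
  using assms by (cases m) (auto simp: odometer_map_def simp del: replicate.simps funpow.simps,
    simp_all add: odometer_map_def)

section \<open>The kernel of the adjoint\<close>

lemma M_perp_iff:
  fixes f :: "('n::{finite, linorder}, 'e::chilbert_space) fock_tensor"
  shows "f \<in> M_perp \<longleftrightarrow> (\<forall>\<nu> \<eta>. \<nu> \<notin> range (\<lambda>m. replicate m first_letter) \<longrightarrow>
    cinner (basis_vec \<nu> \<otimes>\<^sub>H \<eta>) f = 0)"
  unfolding M_perp_def by (rule mem_closure_cspan_basis_tensors)

text \<open>The set on the right is the normal form to which all the descriptions of the kernel are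
  brought.\<close>

lemma ker_cadjoint_odometer:
  fixes L :: "'e::chilbert_space \<Rightarrow> ('n::{finite, linorder}, 'e) fock_tensor"
  assumes "odometer_map L W"
  shows "ker (cadjoint W) =
    {f \<in> M_perp. \<forall>p \<eta>. cinner ((creation first_letter ^^ p) (L \<eta>)) f = 0}"
proof -
  have W: "bounded_clinear W" using assms by (simp add: odometer_map_def)
  \<comment> \<open>The basis tensors are total, so it is enough to test \<open>cadjoint W f\<close>
    against them.\<close>
  have *: "cadjoint W f = 0 \<longleftrightarrow> (\<forall>\<mu> \<eta>. cinner (W (basis_vec \<mu> \<otimes>\<^sub>H \<eta>)) f = 0)" for f
  proof
    assume "\<forall>\<mu> \<eta>. cinner (W (basis_vec \<mu> \<otimes>\<^sub>H \<eta>)) f = 0"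
    hence "\<forall>\<mu> \<eta>. cinner (cadjoint W f) (basis_vec \<mu> \<otimes>\<^sub>H \<eta>) = 0"
      using cinner_cadjoint [OF W] cinner_eq_zero_commute by metis
    hence "cadjoint W f \<in> orth (closure (cspan {basis_vec \<mu> \<otimes>\<^sub>H \<eta> | \<mu> \<eta>. True}))"
      unfolding orth_closure_cspan by (auto simp: orth_def)
    hence "cinner (cadjoint W f) (cadjoint W f) = 0"
      unfolding closure_cspan_tensors by (simp add: orth_def)
    thus "cadjoint W f = 0" by (simp add: cinner_self_eq_zero)
  qed (simp add: cadjoint_eq_zero_iff [OF W])
  have "(\<forall>\<mu> \<eta>. cinner (W (basis_vec \<mu> \<otimes>\<^sub>H \<eta>)) f = 0) \<longleftrightarrow>
      f \<in> M_perp \<and> (\<forall>p \<eta>. cinner ((creation first_letter ^^ p) (L \<eta>)) f = 0)" for f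
  proof
    assume f: "\<forall>\<mu> \<eta>. cinner (W (basis_vec \<mu> \<otimes>\<^sub>H \<eta>)) f = 0"
    \<comment> \<open>Every basis tensor outside \<open>M_perp\<close> is a value of
      \<open>W\<close> on a basis tensor, so \<open>f\<close> is orthogonal to all of them.\<close>
    have "f \<in> M_perp"
      unfolding M_perp_iff using f odometer_map_onto_outside [OF assms] by metis
    thus "f \<in> M_perp \<and> (\<forall>p \<eta>. cinner ((creation first_letter ^^ p) (L \<eta>)) f = 0)"
      using f odometer_map_last_power [OF assms] by metis
  next
    assume f: "f \<in> M_perp \<and> (\<forall>p \<eta>. cinner ((creation first_letter ^^ p) (L \<eta>)) f = 0)"
    show "\<forall>\<mu> \<eta>. cinner (W (basis_vec \<mu> \<otimes>\<^sub>H \<eta>)) f = 0"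
    proof (intro allI)
      fix \<mu> \<eta>
      show "cinner (W (basis_vec \<mu> \<otimes>\<^sub>H \<eta>)) f = 0"
      proof (cases "\<mu> \<in> range (\<lambda>m. replicate m last_letter)")
        case True
        thus ?thesis using f odometer_map_last_power [OF assms] by auto
      next
        case False
        then obtain \<nu> where "\<nu> \<notin> range (\<lambda>m. replicate m first_letter)"
          "\<And>\<eta>. W (basis_vec \<mu> \<otimes>\<^sub>H \<eta>) = basis_vec \<nu> \<otimes>\<^sub>H \<eta>"
          using odometer_map_basis_outside [OF assms] by blast
        thus ?thesis using f unfolding M_perp_iff by simp
      qed
    qed
  qed
  thus ?thesis by (auto simp: ker_on_def *)
qed

lemma csubspace_M_perp: "complex_vector.subspace M_perp"
  unfolding M_perp_def by (intro csubspace_closure complex_vector.subspace_span)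

lemma csubspace_N_perp: "complex_vector.subspace N_perp"
  unfolding N_perp_def by (intro csubspace_closure complex_vector.subspace_span)

text \<open>The part of \<open>W h\<close> removed by the projection is orthogonal to
  \<open>M_perp\<close>, hence invisible to \<open>f\<close>.\<close>

lemma cinner_W22:
  fixes f :: "('n::{finite, linorder}, 'e::chilbert_space) fock_tensor"
  assumes "f \<in> M_perp"
  shows "cinner (W22 W h) f = cinner (W h) f"
proof -
  have "W h - W22 W h \<in> orth M_perp"
    unfolding W22_def by (intro proj csubspace_M_perp) (simp add: M_perp_def)
  thus ?thesis using assms by (simp add: orth_def cinner_diff_left)
qed

text \<open>The projected vector has the same pairings with \<open>N_perp\<close> as
  \<open>cadjoint W f\<close>, and these are the pairings that define the adjoint of the
  compression.\<close>

lemma cadjoint_on_W22: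
  fixes f :: "('n::{finite, linorder}, 'e::chilbert_space) fock_tensor"
  assumes "bounded_clinear W" "f \<in> M_perp"
  shows "cadjoint_on N_perp (W22 W) f = proj N_perp (cadjoint W f)"
proof (rule cadjoint_on_eqI [OF csubspace_N_perp])
  have N: "closed (N_perp :: ('n, 'e) fock_tensor set)" by (simp add: N_perp_def)
  show "proj N_perp (cadjoint W f) \<in> N_perp"
    by (rule proj [OF csubspace_N_perp N])
  fix h :: "('n, 'e) fock_tensor" assume "h \<in> N_perp"
  hence "cinner (cadjoint W f - proj N_perp (cadjoint W f)) h = 0"
    using proj(2) [OF csubspace_N_perp N, of "cadjoint W f"] by (simp add: orth_def)
  hence "cinner h (cadjoint W f - proj N_perp (cadjoint W f)) = 0"
    by (simp only: cinner_eq_zero_commute)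
  thus "cinner (W22 W h) f = cinner h (proj N_perp (cadjoint W f))"
    by (simp add: cinner_W22 [OF assms(2)] cinner_cadjoint [OF assms(1)] cinner_diff_right)
qed

lemma ker_cadjoint_W22:
  fixes L :: "'e::chilbert_space \<Rightarrow> ('n::{finite, linorder}, 'e) fock_tensor"
  assumes "odometer_map L W"
  shows "ker_on M_perp (cadjoint_on N_perp (W22 W)) =
    {f \<in> M_perp. \<forall>p \<eta>. cinner ((creation first_letter ^^ p) (L \<eta>)) f = 0}"
proof -
  have W: "bounded_clinear W" using assms by (simp add: odometer_map_def)
  have N: "closed (N_perp :: ('n, 'e) fock_tensor set)" by (simp add: N_perp_def)
  let ?A = "{basis_vec (replicate m last_letter) \<otimes>\<^sub>H \<xi> | m \<xi>. True} :: ('n, 'e) fock_tensor set"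
  \<comment> \<open>Vanishing of the projected adjoint thus becomes orthogonality to
    \<open>N_perp\<close>, which is tested on its generators, the tensors over powers of the last
    letter.\<close>
  have "proj N_perp g = 0 \<longleftrightarrow> g \<in> orth N_perp" for g :: "('n, 'e) fock_tensor"
  proof
    assume "proj N_perp g = 0"
    thus "g \<in> orth N_perp" using proj(2) [OF csubspace_N_perp N, of g] by simp
  next
    assume "g \<in> orth N_perp"
    thus "proj N_perp g = 0"
      using proj [OF csubspace_N_perp N, of g] complex_vector.subspace_0 [OF csubspace_N_perp]
      by (intro projection_unique [OF csubspace_N_perp, of _ g]) auto
  qed
  moreover have "orth N_perp = orth ?A"
    unfolding N_perp_def by (rule orth_closure_cspan)
  moreover have "cadjoint W f \<in> orth ?A \<longleftrightarrow>
      (\<forall>p \<eta>. cinner ((creation first_letter ^^ p) (L \<eta>)) f = 0)" for f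
  proof -
    have "cadjoint W f \<in> orth ?A \<longleftrightarrow>
        (\<forall>m \<xi>. cinner (basis_vec (replicate m last_letter) \<otimes>\<^sub>H \<xi>) (cadjoint W f) = 0)"
      by (subst cinner_eq_zero_commute) (auto simp: orth_def)
    thus ?thesis
      by (simp add: cinner_cadjoint [OF W, symmetric] odometer_map_last_power [OF assms])
  qed
  ultimately show ?thesis
    by (auto simp: ker_on_def cadjoint_on_W22 [OF W])
qed

lemma cadjoint_creation_powers_eq_zero_iff:
  fixes L :: "'e::chilbert_space \<Rightarrow> ('n::{finite, linorder}, 'e) fock_tensor"
  assumes "bounded_clinear L"
  shows "cadjoint L ((cadjoint (creation i) ^^ p) f) = 0 \<longleftrightarrow>
    (\<forall>\<eta>. cinner ((creation i ^^ p) (L \<eta>)) f = 0)"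
  by (simp add: cadjoint_eq_zero_iff [OF assms] cinner_creation_funpow)

text \<open>The complement inside \<open>E_space L\<close> gives the conditions with
  \<open>p \<ge> 1\<close>; orthogonality to \<open>range L\<close> adds the missing one,
  \<open>p = 0\<close>.\<close>

lemma E_space_inter_orth_range:
  fixes L :: "'e::chilbert_space \<Rightarrow> ('n::{finite, linorder}, 'e) fock_tensor"
  shows "E_space L \<inter> orth (range L) =
    {f \<in> M_perp. \<forall>p \<eta>. cinner ((creation first_letter ^^ p) (L \<eta>)) f = 0}"
proof -
  let ?Q = "\<lambda>f p \<eta>. cinner f ((creation first_letter ^^ p) (L \<eta>)) = 0"
  have "E_space L = {f \<in> M_perp. \<forall>p\<ge>1. \<forall>\<eta>. ?Q f p \<eta>}"
    unfolding E_space_def ominus_def orth_closure_cspan M_perp_def [symmetric]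
    by (auto simp: orth_def)
  moreover have "orth (range L) = {f. \<forall>\<eta>. ?Q f 0 \<eta>}"
    by (auto simp: orth_def)
  moreover have "(\<forall>p \<eta>. ?Q f p \<eta>) \<longleftrightarrow> (\<forall>p\<ge>1. \<forall>\<eta>. ?Q f p \<eta>) \<and> (\<forall>\<eta>. ?Q f 0 \<eta>)" for f
    by (metis less_one not_le)
  moreover have "?Q f p \<eta> \<longleftrightarrow> cinner ((creation first_letter ^^ p) (L \<eta>)) f = 0" for f p \<eta>
    by (rule cinner_eq_zero_commute)
  ultimately show ?thesis by auto
qed

theorem proposition7p1:
  fixes L :: "'e::chilbert_space \<Rightarrow> ('n::{finite, linorder}, 'e) fock_tensor"
    and W :: "('n, 'e) fock_tensor \<Rightarrow> ('n, 'e) fock_tensor"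
  assumes "separable_space (euclidean :: 'e topology)"
    and "bounded_clinear L"
    and "odometer_map L W"
  shows "ker (cadjoint W) = ker_on M_perp (cadjoint_on N_perp (W22 W)) \<and>
    ker_on M_perp (cadjoint_on N_perp (W22 W)) =
      {f \<in> M_perp. \<forall>p. cadjoint L ((cadjoint (creation first_letter) ^^ p) f) = 0} \<and>
    {f \<in> M_perp. \<forall>p. cadjoint L ((cadjoint (creation first_letter) ^^ p) f) = 0} =
      E_space L \<inter> orth (range L) \<and>
    (isometric W \<longrightarrow> ker (cadjoint W) = E_space L \<ominus>\<^sub>H range L)"
  \<comment> \<open>Every set in the claim rewrites to the same normal form;
    \<open>ominus_def\<close> exposes the intersection in the last clause.\<close>
  unfolding ker_cadjoint_odometer [OF assms(3)] ker_cadjoint_W22 [OF assms(3)]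
    cadjoint_creation_powers_eq_zero_iff [OF assms(2)] ominus_def E_space_inter_orth_range
  by simp

end
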